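(* Let $F$ be an algebraically closed field and let $a_1,a_2,a_3\in \mathrm{M}_2(F)$ be distinct matrices forming an irredundant generating set $\{a_1,a_2,a_3\}$ for $\mathrm{M}_2(F)$. Then the tuple $(a_1,a_2,a_3)$ can be transformed into the tuple $$\left(\begin{bmatrix} 1 & 1 \\ 0 & 0 \end{bmatrix},\begin{bmatrix} 0 & 0 \\ 1 & 1 \end{bmatrix},\begin{bmatrix} 1 & 0 \\ 0 & 0 \end{bmatrix}\right)$$ by a finite sequence of the following operations on triples: (1) conjugating $a_1,a_2,a_3$ simultaneously by some $g\in \mathrm{GL}_2(F)$; (2) replacing one of the $a_i$ with $\alpha a_i+\beta I$ for some $\alpha\in F^\times$, $\beta\in F$.
   Context: A subset $S\subseteq \mathrm{M}_n(F)$ is called an irredundant generating set for $\mathrm{M}_n(F)$ if $S$ generates $\mathrm{M}_n(F)$ as a unital $F$-algebra and no proper subset of $S$ does. *)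

theory Defs
  imports "HOL-Analysis.Analysis"
begin

(* Matrices are 'a^'n^'n with A $ i $ j the entry in row i and column j, product **,
   identity mat 1.  The class operations ( * ) and 1 on this type are entrywise and are
   not used.  The library scaling *s takes a scalar of the type of the entries of the
   outer vector (that is, of the rows), hence the following. *)

definition mat_scale :: "'a::field \<Rightarrow> 'a^'n^'m \<Rightarrow> 'a^'n^'m" where
  "mat_scale c A = (\<chi> i j. c * A $ i $ j)"

definition unital_subalgebra :: "('a::field^'n^'n) set \<Rightarrow> bool" where
  "unital_subalgebra B \<longleftrightarrow>
     mat 1 \<in> B \<and>
     (\<forall>x\<in>B. \<forall>y\<in>B. x + y \<in> B) \<and>
     (\<forall>c. \<forall>x\<in>B. mat_scale c x \<in> B) \<and>
     (\<forall>x\<in>B. \<forall>y\<in>B. x ** y \<in> B)"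

definition generates_matrix_algebra :: "('a::field^'n^'n) set \<Rightarrow> bool" where
  "generates_matrix_algebra S \<longleftrightarrow> unital_subalgebra hull S = UNIV"

definition irredundant_generating_set :: "('a::field^'n^'n) set \<Rightarrow> bool" where
  "irredundant_generating_set S \<longleftrightarrow>
     generates_matrix_algebra S \<and> (\<forall>T. T \<subset> S \<longrightarrow> \<not> generates_matrix_algebra T)"

type_synonym ('a, 'n) mat_triple = "('a^'n^'n) \<times> ('a^'n^'n) \<times> ('a^'n^'n)"

definition conjugate_by :: "'a::field^'n^'n \<Rightarrow> 'a^'n^'n \<Rightarrow> 'a^'n^'n" where
  "conjugate_by g a = g ** a ** matrix_inv g"

definition affine_change :: "'a::field \<Rightarrow> 'a \<Rightarrow> 'a^'n^'n \<Rightarrow> 'a^'n^'n" where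
  "affine_change \<alpha> \<beta> a = mat_scale \<alpha> a + mat_scale \<beta> (mat 1)"

inductive triple_step :: "('a::field, 'n::finite) mat_triple \<Rightarrow> ('a, 'n) mat_triple \<Rightarrow> bool" where
  conjugate: "invertible g \<Longrightarrow>
    triple_step (a\<^sub>1, a\<^sub>2, a\<^sub>3) (conjugate_by g a\<^sub>1, conjugate_by g a\<^sub>2, conjugate_by g a\<^sub>3)"
| affine_first: "\<alpha> \<noteq> 0 \<Longrightarrow> triple_step (a\<^sub>1, a\<^sub>2, a\<^sub>3) (affine_change \<alpha> \<beta> a\<^sub>1, a\<^sub>2, a\<^sub>3)"
| affine_second: "\<alpha> \<noteq> 0 \<Longrightarrow> triple_step (a\<^sub>1, a\<^sub>2, a\<^sub>3) (a\<^sub>1, affine_change \<alpha> \<beta> a\<^sub>2, a\<^sub>3)"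
| affine_third: "\<alpha> \<noteq> 0 \<Longrightarrow> triple_step (a\<^sub>1, a\<^sub>2, a\<^sub>3) (a\<^sub>1, a\<^sub>2, affine_change \<alpha> \<beta> a\<^sub>3)"

end

theory Submission
  imports Defs
begin

text \<open>A pair of 2 by 2 matrices that does not generate the full matrix algebra has a common
  eigenvector (the case of dimension 2 of Burnside's theorem). So irredundancy gives eigenvectors
  \<open>v\<^sub>1\<^sub>2\<close>, \<open>v\<^sub>1\<^sub>3\<close>, \<open>v\<^sub>2\<^sub>3\<close>, one for each pair, and since the three matrices have no common eigenvector,
  these vectors are pairwise independent. Each \<open>a\<^sub>i\<close> is then diagonalizable with two distinct
  eigenvalues, and it is determined up to an affine change by its two eigenlines. As
  \<open>GL\<^sub>2\<close> acts transitively on triples of distinct lines of the plane, one can move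
  \<open>v\<^sub>1\<^sub>3\<close>, \<open>v\<^sub>2\<^sub>3\<close>, \<open>v\<^sub>1\<^sub>2\<close> to the lines spanned by
  \<open>(1, 0)\<close>, \<open>(0, 1)\<close>, \<open>(1, -1)\<close>, which are the eigenlines of the target triple.\<close>

text \<open>The determinant with columns \<open>u\<close> and \<open>v\<close>. Its vanishing
  expresses linear dependence, so eigenvectors can be handled without naming an eigenvalue.\<close>

definition cross2 :: "'a::field^2 \<Rightarrow> 'a^2 \<Rightarrow> 'a" where
  "cross2 u v = u $ 1 * v $ 2 - u $ 2 * v $ 1"

lemma cross2_self [simp]: "cross2 v v = 0"
  by (simp add: cross2_def mult.commute)

lemma cross2_scale_left [simp]: "cross2 (c *s u) v = c * cross2 u v"
  by (simp add: cross2_def algebra_simps)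

lemma cross2_scale_right [simp]: "cross2 u (c *s v) = c * cross2 u v"
  by (simp add: cross2_def algebra_simps)

lemma cross2_add_right [simp]: "cross2 u (v + w) = cross2 u v + cross2 u w"
  by (simp add: cross2_def algebra_simps)

lemma cross2_eq_0_imp_scale:
  assumes "v \<noteq> 0" "cross2 v w = 0"
  obtains c where "w = c *s v"
proof (cases "v $ 1 = 0")
  case True
  then have "v $ 2 \<noteq> 0" using assms(1) by (auto simp: vec_eq_iff forall_2)
  then have "w = (w $ 2 / v $ 2) *s v"
    using True assms(2) by (auto simp: vec_eq_iff forall_2 cross2_def)
  then show ?thesis by (rule that)
next
  case False
  then have "w = (w $ 1 / v $ 1) *s v"
    using assms(2) by (auto simp: vec_eq_iff forall_2 cross2_def field_simps)
  then show ?thesis by (rule that)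
qed

text \<open>Cramer's rule in the plane.\<close>

lemma cross2_nonzero_imp_combination:
  assumes "cross2 u v \<noteq> 0"
  obtains s t where "w = s *s u + t *s v"
proof
  show "w = (cross2 w v / cross2 u v) *s u + (cross2 u w / cross2 u v) *s v"
    using assms
    by (simp add: vec_eq_iff forall_2 add_divide_distrib[symmetric] nonzero_eq_divide_eq)
      (simp add: cross2_def algebra_simps)
qed

lemma matrix_eqI_cross2:
  fixes A B :: "'a::field^2^2"
  assumes "cross2 u v \<noteq> 0" "A *v u = B *v u" "A *v v = B *v v"
  shows "A = B"
proof (subst matrix_eq, intro allI)
  fix w
  obtain s t where "w = s *s u + t *s v"
    using cross2_nonzero_imp_combination[OF assms(1)] .
  then show "A *v w = B *v w"
    using assms(2,3) by (simp add: matrix_vector_right_distrib vector_scalar_commute)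
qed

section \<open>Affine changes and inverses of matrices\<close>

lemma mat_scale_mult_vector [simp]: "mat_scale c A *v v = c *s (A *v v)"
  by (simp add: vec_eq_iff mat_scale_def matrix_vector_mult_def sum_distrib_left mult.assoc)

lemma affine_change_mult_vector [simp]:
  "affine_change c d A *v v = c *s (A *v v) + d *s v"
  by (simp add: affine_change_def matrix_vector_mult_add_rdistrib)

lemma matrix_inv_right_left:
  assumes "invertible A"
  shows "A ** matrix_inv A = mat 1" "matrix_inv A ** A = mat 1"
  using someI_ex[OF assms[unfolded invertible_def]] by (simp_all add: matrix_inv_def)

lemma matrix_inv_unique:
  fixes A B :: "'a::field^'n^'n"
  assumes "A ** B = mat 1"
  shows "matrix_inv A = B"
proof -
  have "B ** A = mat 1" using assms by (simp add: matrix_left_right_inverse)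
  then have "invertible A" using assms by (auto simp: invertible_def)
  from matrix_inv_right_left(2)[OF this] show ?thesis
    by (metis assms matrix_mul_assoc matrix_mul_lid matrix_mul_rid)
qed

lemma affine_change_inverse:
  "c \<noteq> 0 \<Longrightarrow> affine_change (1 / c) (- d / c) (affine_change c d A) = A"
  by (subst matrix_eq) (simp add: vec_eq_iff field_simps)

text \<open>For \<open>v \<noteq> 0\<close> the condition \<open>cross2 v (A *v v) = 0\<close> says that \<open>v\<close> is an eigenvector
  of \<open>A\<close>.\<close>

lemma exists_eigenvector:
  fixes A :: "'a::alg_closed_field^2^2"
  obtains v where "v \<noteq> 0" "cross2 v (A *v v) = 0"
proof (cases "A $ 1 $ 2 = 0")
  case True
  show ?thesis
  proof (rule that)
    show "(vector [0, 1] :: 'a^2) \<noteq> 0" by (simp add: vec_eq_iff forall_2)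
    show "cross2 (vector [0, 1]) (A *v vector [0, 1]) = 0"
      using True by (simp add: cross2_def matrix_vector_mult_def sum_2)
  qed
next
  case False
  \<comment> \<open>The vector \<open>(1, t)\<close> is an eigenvector exactly when \<open>t\<close>
    is a root of this quadratic, whose leading coefficient is nonzero in this case.\<close>
  then have "\<exists>t. poly [:- A $ 2 $ 1, A $ 1 $ 1 - A $ 2 $ 2, A $ 1 $ 2:] t = 0"
    by (intro alg_closed_imp_poly_has_root) simp
  then obtain t where t: "poly [:- A $ 2 $ 1, A $ 1 $ 1 - A $ 2 $ 2, A $ 1 $ 2:] t = 0" ..
  show ?thesis
  proof (rule that)
    show "(vector [1, t] :: 'a^2) \<noteq> 0" by (simp add: vec_eq_iff forall_2)
    show "cross2 (vector [1, t]) (A *v vector [1, t]) = 0"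
      using t by (simp add: cross2_def matrix_vector_mult_def sum_2 algebra_simps)
  qed
qed

section \<open>Generation and common eigenvectors\<close>

lemma generates_matrix_algebra_iff:
  "generates_matrix_algebra S \<longleftrightarrow> (\<forall>B. unital_subalgebra B \<longrightarrow> S \<subseteq> B \<longrightarrow> B = UNIV)"
  unfolding generates_matrix_algebra_def hull_def by blast

lemma unital_subalgebra_diff:
  assumes "unital_subalgebra B" "x \<in> B" "y \<in> B"
  shows "x - y \<in> B"
proof -
  have "x - y = x + mat_scale (- 1) y"
    by (simp add: vec_eq_iff mat_scale_def)
  then show ?thesis using assms unfolding unital_subalgebra_def by metis
qed

lemma unital_subalgebra_fixing_line:
  fixes v :: "'a::field^2"
  assumes "v \<noteq> 0"
  shows "unital_subalgebra {A. cross2 v (A *v v) = 0}"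
proof -
  have "cross2 v ((A ** B) *v v) = 0"
    if AB: "cross2 v (A *v v) = 0" "cross2 v (B *v v) = 0" for A B :: "'a^2^2"
  proof -
    obtain c where "B *v v = c *s v"
      using cross2_eq_0_imp_scale[OF assms AB(2)] .
    then show ?thesis
      using AB(1) by (simp add: matrix_vector_mul_assoc[symmetric] vector_scalar_commute)
  qed
  then show ?thesis
    by (simp add: unital_subalgebra_def matrix_vector_mult_add_rdistrib)
qed

lemma exists_not_fixing_line:
  fixes v :: "'a::field^2"
  assumes "v \<noteq> 0"
  shows "\<exists>A. cross2 v (A *v v) \<noteq> 0"
proof (cases "v $ 1 = 0")
  case True
  then have "v $ 2 \<noteq> 0" using assms by (auto simp: vec_eq_iff forall_2)
  then have "cross2 v ((vector [vector [0, 1], vector [0, 0]] :: 'a^2^2) *v v) \<noteq> 0"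
    by (simp add: cross2_def matrix_vector_mult_def sum_2)
  then show ?thesis ..
next
  case False
  then have "cross2 v ((vector [vector [0, 0], vector [1, 0]] :: 'a^2^2) *v v) \<noteq> 0"
    by (simp add: cross2_def matrix_vector_mult_def sum_2)
  then show ?thesis ..
qed

text \<open>The matrices that have \<open>v\<close> as an eigenvector form a proper subalgebra,
  which cannot contain a generating set.\<close>

lemma generates_imp_no_common_eigenvector:
  fixes v :: "'a::field^2"
  assumes "generates_matrix_algebra S" "v \<noteq> 0"
  shows "\<exists>A\<in>S. cross2 v (A *v v) \<noteq> 0"
  using assms exists_not_fixing_line[OF assms(2)] unital_subalgebra_fixing_line[OF assms(2)]
  unfolding generates_matrix_algebra_iff by blast

text \<open>Burnside's theorem in dimension 2, by hand: a subalgebra containing \<open>x\<close> and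
  \<open>y\<close> is shown to contain first every matrix killing a fixed eigenvector
  \<open>v\<close> of \<open>x\<close>, then every matrix.\<close>

lemma no_common_eigenvector_imp_generates:
  fixes x y :: "'a::alg_closed_field^2^2"
  assumes none: "\<And>v. v \<noteq> 0 \<Longrightarrow> cross2 v (x *v v) = 0 \<Longrightarrow> cross2 v (y *v v) \<noteq> 0"
  shows "generates_matrix_algebra {x, y}"
  unfolding generates_matrix_algebra_iff
proof (intro allI impI)
  fix B :: "('a^2^2) set"
  assume B: "unital_subalgebra B" and "{x, y} \<subseteq> B"
  then have x: "x \<in> B" and y: "y \<in> B" by auto
  note closed = B[unfolded unital_subalgebra_def]
  obtain v where v: "v \<noteq> 0" "cross2 v (x *v v) = 0"
    using exists_eigenvector .
  then obtain l where l: "x *v v = l *s v"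
    using cross2_eq_0_imp_scale by blast
  define x' where "x' = x - mat_scale l (mat 1)"
  have x': "x' \<in> B"
    unfolding x'_def using closed x by (intro unital_subalgebra_diff[OF B]) auto
  have x'_apply: "x' *v u = x *v u - l *s u" for u
    by (simp add: x'_def matrix_vector_mult_diff_rdistrib)
  have x'v: "x' *v v = 0" by (simp add: x'_apply l)
  define w where "w = y *v v"
  have vw: "cross2 v w \<noteq> 0" unfolding w_def using none v by blast
  define z where "z = x' *v w"
  \<comment> \<open>Otherwise \<open>x\<close> is scalar, and any eigenvector of \<open>y\<close> is
    a common one.\<close>
  have "z \<noteq> 0"
  proof
    assume "z = 0"
    then have "x' = 0" using matrix_eqI_cross2[OF vw] x'v by (auto simp: z_def)
    then have "x *v u = l *s u" for u using x'_apply[of u] by simp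
    moreover obtain u where "u \<noteq> 0" "cross2 u (y *v u) = 0" using exists_eigenvector .
    ultimately show False using none by simp
  qed
  \<comment> \<open>The image of \<open>x'\<close> lies in the line of \<open>z\<close>, so
    \<open>x'\<close>, and with it \<open>x\<close>, maps \<open>z\<close> to a multiple of
    itself.\<close>
  moreover have "cross2 z (x *v z) = 0"
  proof -
    obtain s t where "z = s *s v + t *s w"
      using cross2_nonzero_imp_combination[OF vw] .
    then have "x' *v z = t *s z"
      by (simp add: matrix_vector_right_distrib vector_scalar_commute x'v z_def[symmetric])
    then have "x *v z = (t + l) *s z"
      using x'_apply[of z] by (simp add: algebra_simps)
    then show ?thesis by simp
  qed
  ultimately have zyz: "cross2 z (y *v z) \<noteq> 0" using none by blast
  \<comment> \<open>\<open>x'\<close> and \<open>y ** x'\<close> kill \<open>v\<close> and send \<open>w\<close> to the basis \<open>z\<close>, \<open>y *v z\<close>,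
    so their combinations are all the matrices that kill \<open>v\<close>.\<close>
  have kill: "\<exists>m\<in>B. m *v v = 0 \<and> m *v w = u" for u
  proof -
    obtain s t where u: "u = s *s z + t *s (y *v z)"
      using cross2_nonzero_imp_combination[OF zyz] .
    define m where "m = mat_scale s x' + mat_scale t (y ** x')"
    have "m \<in> B" unfolding m_def using closed x' y by simp
    moreover have "m *v v = 0" "m *v w = u"
      by (simp_all add: m_def u x'v z_def matrix_vector_mult_add_rdistrib
          matrix_vector_mul_assoc[symmetric])
    ultimately show ?thesis by blast
  qed
  show "B = UNIV"
  proof (intro set_eqI iffI UNIV_I)
    fix m
    \<comment> \<open>Since \<open>y\<close> sends \<open>v\<close> to \<open>w\<close>, the product
      \<open>e ** y\<close> agrees with \<open>m\<close> on \<open>v\<close>; adding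
      \<open>f\<close> corrects the value on \<open>w\<close> and leaves that on \<open>v\<close>
      unchanged.\<close>
    obtain e where e: "e \<in> B" "e *v v = 0" "e *v w = m *v v" using kill by blast
    obtain f where f: "f \<in> B" "f *v v = 0" "f *v w = m *v w - e *v (y *v w)"
      using kill by blast
    have "m = e ** y + f"
      by (rule matrix_eqI_cross2[OF vw])
        (simp_all add: matrix_vector_mult_add_rdistrib matrix_vector_mul_assoc[symmetric]
          w_def[symmetric] e f)
    then show "m \<in> B" using closed e(1) f(1) y by simp
  qed
qed

text \<open>Dropping \<open>c\<close> leaves a pair that does not generate, hence one with a common
  eigenvector; \<open>c\<close> cannot share it because the triple generates.\<close>

lemma irredundant_triple_common_eigenvector:
  fixes a b c :: "'a::alg_closed_field^2^2"
  assumes "irredundant_generating_set {a, b, c}" "c \<noteq> a" "c \<noteq> b"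
  obtains v where "v \<noteq> 0" "cross2 v (a *v v) = 0" "cross2 v (b *v v) = 0" "cross2 v (c *v v) \<noteq> 0"
proof -
  have gen: "generates_matrix_algebra {a, b, c}"
    using assms(1) by (simp add: irredundant_generating_set_def)
  have "{a, b} \<subset> {a, b, c}" using assms(2,3) by auto
  then have "\<not> generates_matrix_algebra {a, b}"
    using assms(1) by (simp add: irredundant_generating_set_def)
  then obtain v where v: "v \<noteq> 0" "cross2 v (a *v v) = 0" "cross2 v (b *v v) = 0"
    using no_common_eigenvector_imp_generates by blast
  then have "cross2 v (c *v v) \<noteq> 0"
    using generates_imp_no_common_eigenvector[OF gen v(1)] by auto
  with v show ?thesis by (rule that)
qed

section \<open>Reduction to the normal form\<close>

lemma cross2_nonzero_if_distinguished:
  assumes "u \<noteq> 0" "v \<noteq> 0" "cross2 u (a *v u) = 0" "cross2 v (a *v v) \<noteq> 0"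
  shows "cross2 u v \<noteq> 0"
proof
  assume "cross2 u v = 0"
  then obtain c where "v = c *s u" using cross2_eq_0_imp_scale[OF assms(1)] by blast
  then show False using assms(3,4) by (simp add: vector_scalar_commute)
qed

text \<open>Here \<open>b\<close> is the projection onto the line of \<open>p\<close> along
  \<open>q\<close>, and \<open>h\<close> carries these two lines to eigenlines of \<open>a\<close>.
  The vector \<open>r\<close> rules out that \<open>a\<close> is scalar, so its two eigenvalues
  differ.\<close>

lemma conjugate_diagonalizable:
  fixes a b h :: "'a::field^2^2"
  assumes "invertible h" "cross2 p q \<noteq> 0"
    and u: "h *v p = u" "cross2 u (a *v u) = 0" "u \<noteq> 0"
    and v: "h *v q = v" "cross2 v (a *v v) = 0" "v \<noteq> 0"
    and uv: "cross2 u v \<noteq> 0"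
    and b: "b *v p = p" "b *v q = 0"
    and not_scalar: "cross2 r (a *v r) \<noteq> 0"
  obtains c d where "c \<noteq> 0" "conjugate_by (matrix_inv h) a = affine_change c d b"
proof -
  obtain l where l: "a *v u = l *s u" using cross2_eq_0_imp_scale[OF u(3,2)] .
  obtain m where m: "a *v v = m *s v" using cross2_eq_0_imp_scale[OF v(3,2)] .
  have inv: "h ** matrix_inv h = mat 1" "matrix_inv h ** h = mat 1"
    using matrix_inv_right_left[OF assms(1)] .
  then have inv_inv: "matrix_inv (matrix_inv h) = h"
    by (intro matrix_inv_unique)
  have "l - m \<noteq> 0"
  proof
    assume "l - m = 0"
    then have "a = mat_scale l (mat 1)" using l m by (intro matrix_eqI_cross2[OF uv]) simp_all
    then show False using not_scalar by simp
  qed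
  \<comment> \<open>The affine change of \<open>b\<close> is chosen to have eigenvalue
    \<open>l\<close> at \<open>p\<close> and \<open>m\<close> at \<open>q\<close>.\<close>
  moreover have "a ** h = h ** affine_change (l - m) m b"
  proof (rule matrix_eqI_cross2[OF assms(2)])
    show "(a ** h) *v p = (h ** affine_change (l - m) m b) *v p"
      using l by (simp add: matrix_vector_mul_assoc[symmetric] u(1) b
          vector_scalar_commute)
    show "(a ** h) *v q = (h ** affine_change (l - m) m b) *v q"
      using m by (simp add: matrix_vector_mul_assoc[symmetric] v(1) b vector_scalar_commute)
  qed
  then have "conjugate_by (matrix_inv h) a = affine_change (l - m) m b"
    by (simp add: conjugate_by_def inv_inv matrix_mul_assoc[symmetric])
      (simp add: matrix_mul_assoc inv)
  ultimately show ?thesis by (rule that)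
qed

lemma triple_steps_undo_affine_changes:
  assumes "c\<^sub>1 \<noteq> 0" "c\<^sub>2 \<noteq> 0" "c\<^sub>3 \<noteq> 0"
  shows "triple_step\<^sup>*\<^sup>*
    (affine_change c\<^sub>1 d\<^sub>1 b\<^sub>1, affine_change c\<^sub>2 d\<^sub>2 b\<^sub>2, affine_change c\<^sub>3 d\<^sub>3 b\<^sub>3) (b\<^sub>1, b\<^sub>2, b\<^sub>3)"
proof -
  let ?b1 = "affine_change c\<^sub>1 d\<^sub>1 b\<^sub>1" and ?b2 = "affine_change c\<^sub>2 d\<^sub>2 b\<^sub>2"
  let ?b3 = "affine_change c\<^sub>3 d\<^sub>3 b\<^sub>3"
  have "triple_step (?b1, ?b2, ?b3) (b\<^sub>1, ?b2, ?b3)"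
    using affine_first[of "1 / c\<^sub>1" ?b1 ?b2 ?b3 "- d\<^sub>1 / c\<^sub>1"] assms affine_change_inverse[of c\<^sub>1 d\<^sub>1 b\<^sub>1]
    by simp
  moreover have "triple_step (b\<^sub>1, ?b2, ?b3) (b\<^sub>1, b\<^sub>2, ?b3)"
    using affine_second[of "1 / c\<^sub>2" b\<^sub>1 ?b2 ?b3 "- d\<^sub>2 / c\<^sub>2"] assms affine_change_inverse[of c\<^sub>2 d\<^sub>2 b\<^sub>2]
    by simp
  moreover have "triple_step (b\<^sub>1, b\<^sub>2, ?b3) (b\<^sub>1, b\<^sub>2, b\<^sub>3)"
    using affine_third[of "1 / c\<^sub>3" b\<^sub>1 b\<^sub>2 ?b3 "- d\<^sub>3 / c\<^sub>3"] assms affine_change_inverse[of c\<^sub>3 d\<^sub>3 b\<^sub>3]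
    by simp
  ultimately show ?thesis
    by (blast intro: converse_rtranclp_into_rtranclp)
qed

theorem proposition4p3:
  fixes a\<^sub>1 a\<^sub>2 a\<^sub>3 :: "'a::alg_closed_field^2^2"
  assumes "distinct [a\<^sub>1, a\<^sub>2, a\<^sub>3]"
    and "irredundant_generating_set {a\<^sub>1, a\<^sub>2, a\<^sub>3}"
  shows "triple_step\<^sup>*\<^sup>* (a\<^sub>1, a\<^sub>2, a\<^sub>3)
    (vector [vector [1, 1], vector [0, 0]],
     vector [vector [0, 0], vector [1, 1]],
     vector [vector [1, 0], vector [0, 0]])"
proof -
  have ne: "a\<^sub>1 \<noteq> a\<^sub>2" "a\<^sub>1 \<noteq> a\<^sub>3" "a\<^sub>2 \<noteq> a\<^sub>3" using assms(1) by auto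
  obtain v where v: "v \<noteq> 0" "cross2 v (a\<^sub>1 *v v) = 0" "cross2 v (a\<^sub>2 *v v) = 0"
      "cross2 v (a\<^sub>3 *v v) \<noteq> 0"
    by (rule irredundant_triple_common_eigenvector[OF assms(2)]) (use ne in auto)
  \<comment> \<open>Reordering puts the matrix to be dropped in the last place.\<close>
  have "{a\<^sub>1, a\<^sub>3, a\<^sub>2} = {a\<^sub>1, a\<^sub>2, a\<^sub>3}" "{a\<^sub>2, a\<^sub>3, a\<^sub>1} = {a\<^sub>1, a\<^sub>2, a\<^sub>3}" by auto
  note irr = assms(2)[folded this(1)] assms(2)[folded this(2)]
  obtain u\<^sub>0 where u0: "u\<^sub>0 \<noteq> 0" "cross2 u\<^sub>0 (a\<^sub>1 *v u\<^sub>0) = 0" "cross2 u\<^sub>0 (a\<^sub>3 *v u\<^sub>0) = 0"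
      "cross2 u\<^sub>0 (a\<^sub>2 *v u\<^sub>0) \<noteq> 0"
    by (rule irredundant_triple_common_eigenvector[OF irr(1)]) (use ne in auto)
  obtain w\<^sub>0 where w0: "w\<^sub>0 \<noteq> 0" "cross2 w\<^sub>0 (a\<^sub>2 *v w\<^sub>0) = 0" "cross2 w\<^sub>0 (a\<^sub>3 *v w\<^sub>0) = 0"
      "cross2 w\<^sub>0 (a\<^sub>1 *v w\<^sub>0) \<noteq> 0"
    by (rule irredundant_triple_common_eigenvector[OF irr(2)]) (use ne in auto)
  have uw0: "cross2 u\<^sub>0 w\<^sub>0 \<noteq> 0" using cross2_nonzero_if_distinguished u0 w0 by blast
  have uv0: "cross2 u\<^sub>0 v \<noteq> 0" using cross2_nonzero_if_distinguished u0 v by blast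
  have wv0: "cross2 w\<^sub>0 v \<noteq> 0" using cross2_nonzero_if_distinguished w0 v by blast
  obtain s t where st: "v = s *s u\<^sub>0 + t *s w\<^sub>0"
    using cross2_nonzero_imp_combination[OF uw0] .
  have nz: "s \<noteq> 0" "t \<noteq> 0"
    using uv0 wv0 by (auto simp: st)
  \<comment> \<open>Rescaled so that \<open>v = u - w\<close>, matching
    \<open>(1, -1) = (1, 0) - (0, 1)\<close>.\<close>
  define u where "u = s *s u\<^sub>0"
  define w where "w = (- t) *s w\<^sub>0"
  have u: "u \<noteq> 0" "cross2 u (a\<^sub>1 *v u) = 0" "cross2 u (a\<^sub>3 *v u) = 0"
    using u0 nz by (simp_all add: u_def vector_scalar_commute)
  have w: "w \<noteq> 0" "cross2 w (a\<^sub>2 *v w) = 0" "cross2 w (a\<^sub>3 *v w) = 0"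
    unfolding w_def using w0 nz by (simp_all only: vector_scalar_commute cross2_scale_left
        cross2_scale_right vector_mul_eq_0 neg_equal_0_iff_equal mult_zero_right) simp
  have uw: "cross2 u w \<noteq> 0" and uv: "cross2 u v \<noteq> 0" and wv: "cross2 w v \<noteq> 0"
    unfolding u_def w_def using uw0 uv0 wv0 nz by (simp_all only: cross2_scale_left
        cross2_scale_right mult_eq_0_iff neg_equal_0_iff_equal simp_thms not_False_eq_True)
  define h :: "'a^2^2" where "h = vector [vector [u $ 1, w $ 1], vector [u $ 2, w $ 2]]"
  have he: "h *v vector [1, 0] = u" "h *v vector [0, 1] = w"
    by (simp_all add: h_def vec_eq_iff forall_2 matrix_vector_mult_def sum_2)
  have hv: "h *v vector [1, - 1] = v"
    by (simp add: h_def st u_def w_def vec_eq_iff forall_2 matrix_vector_mult_def sum_2)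
  have "det h = cross2 u w"
    by (simp add: h_def det_2 cross2_def mult.commute)
  then have h: "invertible h" using uw by (simp add: invertible_det_nz)
  then have g: "invertible (matrix_inv h)"
    using matrix_inv_right_left[OF h] by (auto simp: invertible_def)
  note calc = cross2_def vec_eq_iff forall_2 matrix_vector_mult_def sum_2
  \<comment> \<open>Each target matrix is a projection: it fixes one of the three model vectors and
    kills another. The common eigenvector of the other two matrices shows that the current one is
    not scalar.\<close>
  obtain c\<^sub>1 d\<^sub>1 where 1: "c\<^sub>1 \<noteq> 0" "conjugate_by (matrix_inv h) a\<^sub>1 =
      affine_change c\<^sub>1 d\<^sub>1 (vector [vector [1, 1], vector [0, 0]])"
    by (rule conjugate_diagonalizable[OF h _ he(1) u(2,1) hv v(2,1) uv _ _ w0(4),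
          where b = "vector [vector [1, 1], vector [0, 0]]"]) (simp_all add: calc)
  obtain c\<^sub>2 d\<^sub>2 where 2: "c\<^sub>2 \<noteq> 0" "conjugate_by (matrix_inv h) a\<^sub>2 =
      affine_change c\<^sub>2 d\<^sub>2 (vector [vector [0, 0], vector [1, 1]])"
    by (rule conjugate_diagonalizable[OF h _ he(2) w(2,1) hv v(3,1) wv _ _ u0(4),
          where b = "vector [vector [0, 0], vector [1, 1]]"]) (simp_all add: calc)
  obtain c\<^sub>3 d\<^sub>3 where 3: "c\<^sub>3 \<noteq> 0" "conjugate_by (matrix_inv h) a\<^sub>3 =
      affine_change c\<^sub>3 d\<^sub>3 (vector [vector [1, 0], vector [0, 0]])"
    by (rule conjugate_diagonalizable[OF h _ he(1) u(3,1) he(2) w(3,1) uw _ _ v(4),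
          where b = "vector [vector [1, 0], vector [0, 0]]"]) (simp_all add: calc)
  show ?thesis
    using conjugate[OF g, of a\<^sub>1 a\<^sub>2 a\<^sub>3] triple_steps_undo_affine_changes[OF 1(1) 2(1) 3(1)]
    unfolding 1(2) 2(2) 3(2) by (rule converse_rtranclp_into_rtranclp)
qed

end
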